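(* Let $q\ge 1$ be an integer and let $K$ be the knot or link that is the closure of the $4$-braid $(\sigma_1\sigma_2\sigma_3^{-1})^q$. Then the unknotting number of $K$ satisfies \[u(K)\le \begin{cases} q & \text{if } 4\mid q,\\ q-1 & \text{otherwise}.\end{cases}\] This upper bound is sharp in the sense that equality holds for $q=3$ (where $K$ is $9_{47}$, with unknotting number $2$).
   Context: $\sigma_1,\sigma_2,\sigma_3$ are the standard Artin generators of the braid group $B_4$. The unknotting number $u(K)$ of a knot or link $K$ in $S^3$ is the minimal number of crossing changes needed to turn $K$ into a trivial link (with the same number of components). The knot name $9_{47}$ is that of the standard (Rolfsen) table. *)

theory Defs
  imports Main
begin

text \<open>
  Unoriented links in the 3-sphere are represented by sliced (Morse position) link diagrams modulo
  Reidemeister moves and planar isotopy.  Every link has such a diagram, and by the version of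
  Reidemeister's theorem for sliced diagrams (Freyd--Yetter, Turaev) two of them represent isotopic
  links if and only if they are connected by the moves listed below.

  A diagram is read from bottom to top as a list of slices.  The slice \<open>(i, g)\<close> consists of \<open>i\<close>
  vertical strands, then the elementary piece \<open>g\<close>, then further vertical strands; the positions of
  the strands between two slices are numbered from 0, left to right.
  \<open>Cup\<close> is a local minimum (two new strands start), \<open>Cap\<close> is a local maximum (two adjacent strands
  are joined), and \<open>Cross b\<close> is a crossing of two adjacent strands.  For \<open>b = True\<close> the strand from
  the lower left to the upper right passes over, for \<open>b = False\<close> the other one does.
\<close>

datatype piece = Cup | Cap | Cross bool

type_synonym slice = "nat \<times> piece"

fun inputs :: "piece \<Rightarrow> nat" where
  "inputs Cup = 0"
| "inputs Cap = 2"
| "inputs (Cross b) = 2"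

fun outputs :: "piece \<Rightarrow> nat" where
  "outputs Cup = 2"
| "outputs Cap = 0"
| "outputs (Cross b) = 2"

text \<open>\<open>width m D\<close> is the number of strands above \<open>D\<close> if there are \<open>m\<close> strands below it.\<close>

fun width :: "nat \<Rightarrow> slice list \<Rightarrow> nat" where
  "width m [] = m"
| "width m ((i, g) # D) = width (m - inputs g + outputs g) D"

fun fits :: "nat \<Rightarrow> slice list \<Rightarrow> bool" where
  "fits m [] \<longleftrightarrow> True"
| "fits m ((i, g) # D) \<longleftrightarrow> i + inputs g \<le> m \<and> fits (m - inputs g + outputs g) D"

definition link_diagram :: "slice list \<Rightarrow> bool" where
  "link_diagram D \<longleftrightarrow> fits 0 D \<and> width 0 D = 0"

text \<open>
  The local moves: first planar isotopy (exchanging the heights of two pieces lying side by side,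
  straightening a zigzag, sliding a strand across a local extremum), then the three Reidemeister
  moves.  In \<open>cup_slide\<close> and \<open>cap_slide\<close> the same strand passes over on both sides, although the
  flag of the crossing changes.
\<close>

inductive local_move :: "slice list \<Rightarrow> slice list \<Rightarrow> bool" where
  height: "i \<le> j \<Longrightarrow> local_move [(i, g), (j + outputs g, h)] [(j + inputs g, h), (i, g)]"
| zigzag_left: "local_move [(i, Cup), (Suc i, Cap)] []"
| zigzag_right: "local_move [(Suc i, Cup), (i, Cap)] []"
| cup_slide: "local_move [(i, Cup), (Suc i, Cross b)] [(Suc i, Cup), (i, Cross (\<not> b))]"
| cap_slide: "local_move [(Suc i, Cross b), (i, Cap)] [(i, Cross (\<not> b)), (Suc i, Cap)]"
| R1: "local_move [(Suc i, Cup), (i, Cross b), (Suc i, Cap)] []"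
| R2: "local_move [(i, Cross b), (i, Cross (\<not> b))] []"
| R3: "local_move [(i, Cross b), (Suc i, Cross b), (i, Cross b)]
                  [(Suc i, Cross b), (i, Cross b), (Suc i, Cross b)]"

inductive diagram_move :: "slice list \<Rightarrow> slice list \<Rightarrow> bool" where
  "local_move L R \<Longrightarrow> link_diagram (U @ L @ V) \<Longrightarrow> link_diagram (U @ R @ V) \<Longrightarrow>
     diagram_move (U @ L @ V) (U @ R @ V)"

definition link_equiv :: "slice list \<Rightarrow> slice list \<Rightarrow> bool" where
  "link_equiv = equivclp diagram_move"

text \<open>
  Components are counted on the points \<open>(t, j)\<close>, where \<open>j\<close> is the position of a strand just below
  slice number \<open>t\<close> (slices numbered from 0; for \<open>t = length D\<close>, above the last slice).
  \<open>joined D\<close> relates two points that are the ends of an arc inside one slice.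
\<close>

inductive joined :: "slice list \<Rightarrow> nat \<times> nat \<Rightarrow> nat \<times> nat \<Rightarrow> bool" for D where
  left: "t < length D \<Longrightarrow> D ! t = (i, g) \<Longrightarrow> j < i \<Longrightarrow> joined D (t, j) (Suc t, j)"
| right: "t < length D \<Longrightarrow> D ! t = (i, g) \<Longrightarrow>
            joined D (t, i + inputs g + j) (Suc t, i + outputs g + j)"
| cup: "t < length D \<Longrightarrow> D ! t = (i, Cup) \<Longrightarrow> joined D (Suc t, i) (Suc t, Suc i)"
| cap: "t < length D \<Longrightarrow> D ! t = (i, Cap) \<Longrightarrow> joined D (t, i) (t, Suc i)"
| cross_up: "t < length D \<Longrightarrow> D ! t = (i, Cross b) \<Longrightarrow> joined D (t, i) (Suc t, Suc i)"
| cross_down: "t < length D \<Longrightarrow> D ! t = (i, Cross b) \<Longrightarrow> joined D (t, Suc i) (Suc t, i)"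

definition points :: "slice list \<Rightarrow> (nat \<times> nat) set" where
  "points D = {(t, j). t \<le> length D \<and> j < width 0 (take t D)}"

definition components :: "slice list \<Rightarrow> nat" where
  "components D =
     card (points D // {(p, q). p \<in> points D \<and> q \<in> points D \<and> equivclp (joined D) p q})"

definition trivial_link :: "nat \<Rightarrow> slice list" where
  "trivial_link c = concat (replicate c [(0, Cup), (0, Cap)])"

inductive crossing_change :: "slice list \<Rightarrow> slice list \<Rightarrow> bool" where
  "link_diagram (U @ [(i, Cross b)] @ V) \<Longrightarrow>
     crossing_change (U @ [(i, Cross b)] @ V) (U @ [(i, Cross (\<not> b))] @ V)"

text \<open>\<open>crossing_changes n D E\<close>: the link of \<open>D\<close> can be turned into that of \<open>E\<close> by \<open>n\<close> crossing
  changes, with isotopies allowed before, between and after them.\<close>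

inductive crossing_changes :: "nat \<Rightarrow> slice list \<Rightarrow> slice list \<Rightarrow> bool" where
  isotopy: "link_equiv D E \<Longrightarrow> crossing_changes 0 D E"
| change: "crossing_changes n D E \<Longrightarrow> crossing_change E E' \<Longrightarrow> link_equiv E' F \<Longrightarrow>
             crossing_changes (Suc n) D F"

text \<open>The minimum is over a nonempty set for every link diagram, since every diagram becomes
  descending after finitely many crossing changes.\<close>

definition unknotting_number :: "slice list \<Rightarrow> nat" where
  "unknotting_number D = (LEAST n. crossing_changes n D (trivial_link (components D)))"

text \<open>
  Closure of a tangle with \<open>n\<close> strands at the bottom and at the top: the tangle occupies the left
  \<open>n\<close> of \<open>2 * n\<close> positions, and its \<open>n\<close> ends are joined by nested arcs passing on its right.
\<close>

definition tangle_closure :: "nat \<Rightarrow> slice list \<Rightarrow> slice list" where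
  "tangle_closure n T = map (\<lambda>i. (i, Cup)) [0..<n] @ T @ map (\<lambda>i. (i, Cap)) (rev [0..<n])"

text \<open>The letter \<open>(i, True)\<close> of a braid word is the Artin generator \<open>\<sigma>\<^sub>i\<close> (with \<open>i \<ge> 1\<close>),
  and \<open>(i, False)\<close> is its inverse.\<close>

type_synonym braid_word = "(nat \<times> bool) list"

abbreviation sigma :: "nat \<Rightarrow> nat \<times> bool" where
  "sigma i \<equiv> (i, True)"

abbreviation sigma_inv :: "nat \<Rightarrow> nat \<times> bool" where
  "sigma_inv i \<equiv> (i, False)"

definition braid_slices :: "braid_word \<Rightarrow> slice list" where
  "braid_slices w = map (\<lambda>(i, b). (i - 1, Cross b)) w"

definition braid_closure :: "nat \<Rightarrow> braid_word \<Rightarrow> slice list" where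
  "braid_closure n w = tangle_closure n (braid_slices w)"

definition braid_power :: "braid_word \<Rightarrow> nat \<Rightarrow> braid_word" where
  "braid_power w q = concat (replicate q w)"

text \<open>
  The standard diagram of \<open>9\<^sub>4\<^sub>7\<close>, with Conway notation 8*-20 and Dowker--Thistlethwaite code
  6 8 10 16 14 -18 4 2 -12.  The basic polyhedron 8* is the closure of the alternating 3-braid
  \<open>(\<sigma>\<^sub>1\<^sup>-\<^sup>1 \<sigma>\<^sub>2)\<^sup>4\<close>; one crossing \<open>\<sigma>\<^sub>1\<^sup>-\<^sup>1\<close> is replaced by the tangle -20, a row of two crossings side by side,
  signed so that the diagram is not alternating.  (The opposite sign gives 8*20, that is \<open>9\<^sub>3\<^sub>4\<close>.)
  The table lists knots up to mirror image; the diagram here is the one of the two mirror images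
  that fits the sign convention for crossings chosen above.
\<close>

definition knot_9_47 :: "slice list" where
  "knot_9_47 = tangle_closure 3
     ([(1, Cup), (0, Cross True), (2, Cross True), (1, Cap)] @
      braid_slices (sigma 2 # braid_power [sigma_inv 1, sigma 2] 3))"

end

(*
  In the braid (s1 s2 s3^-1)^4 every strand returns to its place.  Four crossing changes make
  strand 0 pass over strands 1, 2, 3, strand 1 over strands 2, 3, and strand 2 over strand 3, which
  turns the braid into the identity.  Hence q drops by 4 at the cost of four crossing changes, and
  q = 0, 1, 2, 3 need 0, 0, 1, 2 changes.

  The number of colourings of a diagram by a finite kei (involutory quandle) is an invariant.  With
  the trivial kei on two elements it is 2 to the number of components, also unchanged by crossing
  changes, which gives the number of components of every closure as soon as it has been turned
  into a trivial link.  With the dihedral kei of order 3 (Fox colourings) a crossing change alters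
  it by a factor of at most 3: the colourings that are constant at the crossing are the same before
  and after, and they form a subgroup of index at most 3.  The closure for q = 3 has 27 colourings
  and the unknot has 3, so at least two crossing changes are needed.
*)
theory Submission
  imports Defs
begin

section \<open>Invariance of kei colourings\<close>

text \<open>A row assigns colours to infinitely many strand positions.  Those beyond the width of the
  diagram are passed along unchanged, so that no width conditions are needed.\<close>

definition insert2 :: "nat \<Rightarrow> 'a \<Rightarrow> (nat \<Rightarrow> 'a) \<Rightarrow> nat \<Rightarrow> 'a" where
  "insert2 i c s = (\<lambda>j. if j < i then s j else if j < i + 2 then c else s (j - 2))"

definition delete2 :: "nat \<Rightarrow> (nat \<Rightarrow> 'a) \<Rightarrow> nat \<Rightarrow> 'a" where
  "delete2 i s = (\<lambda>j. if j < i then s j else s (j + 2))"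

text \<open>The over strand keeps its colour and acts on that of the under strand. As the action of
  a kei is an involution, no orientation of the strands enters.\<close>

definition twist :: "('a \<Rightarrow> 'a \<Rightarrow> 'a) \<Rightarrow> bool \<Rightarrow> nat \<Rightarrow> (nat \<Rightarrow> 'a) \<Rightarrow> nat \<Rightarrow> 'a" where
  "twist act b i s =
     (if b then s(i := act (s (Suc i)) (s i), Suc i := s i)
      else s(i := s (Suc i), Suc i := act (s i) (s (Suc i))))"

text \<open>\<open>paint act D k s\<close> sums \<open>k\<close> over the top rows of all colourings of \<open>D\<close> with bottom row \<open>s\<close>.\<close>

fun paint :: "('a::finite \<Rightarrow> 'a \<Rightarrow> 'a) \<Rightarrow> slice list \<Rightarrow> ((nat \<Rightarrow> 'a) \<Rightarrow> nat) \<Rightarrow> (nat \<Rightarrow> 'a) \<Rightarrow> nat" where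
  "paint act [] k s = k s"
| "paint act ((i, Cup) # D) k s = (\<Sum>c\<in>UNIV. paint act D k (insert2 i c s))"
| "paint act ((i, Cap) # D) k s = (if s i = s (Suc i) then paint act D k (delete2 i s) else 0)"
| "paint act ((i, Cross b) # D) k s = paint act D k (twist act b i s)"

definition colours :: "('a::finite \<Rightarrow> 'a \<Rightarrow> 'a) \<Rightarrow> slice list \<Rightarrow> (nat \<Rightarrow> 'a) \<Rightarrow> nat" where
  "colours act D s = paint act D (\<lambda>_. 1) s"

text \<open>The three axioms correspond to the first, second and third Reidemeister moves.\<close>

definition kei :: "('a \<Rightarrow> 'a \<Rightarrow> 'a) \<Rightarrow> bool" where
  "kei act \<longleftrightarrow> (\<forall>x. act x x = x) \<and> (\<forall>x y. act (act x y) y = x) \<and>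
     (\<forall>x y z. act (act x y) z = act (act x z) (act y z))"

text \<open>This is why \<open>paint\<close> carries a continuation \<open>k\<close>: an equality
  proved for a small piece and arbitrary \<open>k\<close> holds inside every larger diagram.\<close>

lemma paint_append: "paint act (U @ V) k = paint act U (paint act V k)"
proof
  show "paint act (U @ V) k s = paint act U (paint act V k) s" for s
    by (induction act U "paint act V k" s rule: paint.induct) auto
qed

lemmas row_defs = insert2_def delete2_def twist_def

lemma paint_height:
  assumes "i \<le> j"
  shows "paint act [(i, g), (j + outputs g, h)] k s = paint act [(j + inputs g, h), (i, g)] k s"
proof -
  \<comment> \<open>The nine facts run through the pairs of pieces. Each says that row operations at
    disjoint positions commute, up to the shift by two that a cup or a cap causes.\<close>
  have 1: "insert2 (j + 2) d (insert2 i c s) = insert2 i c (insert2 j d s)" for c d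
    unfolding row_defs using assms by (auto simp: fun_eq_iff intro!: arg_cong[of _ _ s])
  have 2: "delete2 (j + 2) (insert2 i c s) = insert2 i c (delete2 j s)" for c
    unfolding row_defs using assms by (auto simp: fun_eq_iff Suc_diff_le intro!: arg_cong[of _ _ s] arg_cong2[of _ _ _ _ act])
  have 3: "twist act b (j + 2) (insert2 i c s) = insert2 i c (twist act b j s)" for b c
    unfolding row_defs using assms by (auto simp: fun_eq_iff Suc_diff_le intro!: arg_cong[of _ _ s] arg_cong2[of _ _ _ _ act])
  have 4: "insert2 j c (delete2 i s) = delete2 i (insert2 (j + 2) c s)" for c
    unfolding row_defs using assms by (auto simp: fun_eq_iff intro!: arg_cong[of _ _ s])
  have 5: "delete2 j (delete2 i s) = delete2 i (delete2 (j + 2) s)"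
    unfolding row_defs using assms by (auto simp: fun_eq_iff intro!: arg_cong[of _ _ s])
  have 6: "twist act b j (delete2 i s) = delete2 i (twist act b (j + 2) s)" for b
    unfolding row_defs using assms by (auto simp: fun_eq_iff intro!: arg_cong[of _ _ s])
  have 7: "insert2 (j + 2) c (twist act b i s) = twist act b i (insert2 (j + 2) c s)" for b c
    unfolding row_defs using assms by (auto simp: fun_eq_iff intro!: arg_cong[of _ _ s])
  have 8: "delete2 (j + 2) (twist act b i s) = twist act b i (delete2 (j + 2) s)" for b
    unfolding row_defs using assms by (auto simp: fun_eq_iff intro!: arg_cong[of _ _ s])
  have 9: "twist act a (j + 2) (twist act b i s) = twist act b i (twist act a (j + 2) s)" for a b
    unfolding row_defs using assms by (auto simp: fun_eq_iff intro!: arg_cong[of _ _ s])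
  note eqs = 1 2 3 4 5 6 7 8 9
  \<comment> \<open>A cap tests two neighbouring colours; the piece beside it does not alter
    them.\<close>
  have ev: "insert2 i c s (j + 2) = s j" "insert2 i c s (Suc (j + 2)) = s (Suc j)"
    "delete2 i s j = s (j + 2)" "delete2 i s (Suc j) = s (Suc (j + 2))"
    "twist act b i s (j + 2) = s (j + 2)" "twist act b i s (Suc (j + 2)) = s (Suc (j + 2))"
    "insert2 (j + 2) c s i = s i" "insert2 (j + 2) c s (Suc i) = s (Suc i)"
    "delete2 (j + 2) s i = s i" "delete2 (j + 2) s (Suc i) = s (Suc i)"
    "twist act b (j + 2) s i = s i" "twist act b (j + 2) s (Suc i) = s (Suc i)" for b c
    unfolding row_defs using assms by (auto simp: Suc_diff_le)
  show ?thesis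
  \<comment> \<open>Two cups give a double sum whose order must be exchanged; the other pairs follow
    from the identities above.\<close>
  proof (cases "g = Cup \<and> h = Cup")
    case True
    then show ?thesis by (simp add: eqs(1)[unfolded add_2_eq_Suc'] sum.swap[of "\<lambda>c d. k (insert2 i c (insert2 j d s))"])
  next
    case False
    then show ?thesis
      by (cases g; cases h)
         (simp_all only: paint.simps inputs.simps outputs.simps add_0_right eqs ev sum.neutral_const
            piece.distinct piece.inject simp_thms split: if_split, auto)
  qed
qed

text \<open>At a zigzag or a curl the cap forces the colour of the cup, so a single summand
  survives. \<open>R2\<close> and \<open>R3\<close> are identities between rows, by the involution
  and distributivity laws.\<close>

lemma paint_local_move:
  assumes "kei act" "local_move L R"
  shows "paint act L k s = paint act R k s"
proof -
  have idem: "act x x = x" and invol: "act (act x y) y = x"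
    and dist: "act (act x z) (act y z) = act (act x y) z" for x y z
    using assms(1) unfolding kei_def by auto
  have invol_eq: "act x y = z \<longleftrightarrow> x = act z y" for x y z
    using invol by metis
  show ?thesis
    using assms(2)
  proof cases
    case (height i j g h)
    then show ?thesis by (simp only: paint_height)
  next
    case (zigzag_left i)
    have "insert2 i c s i = c" "insert2 i c s (Suc i) = c" "insert2 i c s (Suc (Suc i)) = s i"
      "delete2 (Suc i) (insert2 i (s i) s) = s" for c
      by (auto simp: row_defs fun_eq_iff less_Suc_eq)
    then show ?thesis
      unfolding zigzag_left by simp
  next
    case (zigzag_right i)
    have "insert2 (Suc i) c s i = s i" "insert2 (Suc i) c s (Suc i) = c"
      "delete2 i (insert2 (Suc i) (s i) s) = s" for c
      by (auto simp: row_defs fun_eq_iff intro!: arg_cong[of _ _ s])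
    then show ?thesis
      unfolding zigzag_right by simp
  next
    case (cup_slide i b)
    show ?thesis
    proof (cases b)
      case True
      have "twist act True (Suc i) (insert2 i c s) = twist act False i (insert2 (Suc i) c s)" for c
        by (auto simp: row_defs fun_eq_iff intro!: arg_cong[of _ _ s])
      then show ?thesis unfolding cup_slide using True by simp
    next
      case False
      \<comment> \<open>Here the vertical strand passes over the cup, so the two ends of the cup get
        different colours, related by the action of \<open>s i\<close>. The two sums agree after
        reindexing by this involution.\<close>
      have "twist act False (Suc i) (insert2 i (act c (s i)) s) = twist act True i (insert2 (Suc i) c s)" for c
        by (auto simp: row_defs fun_eq_iff invol intro!: arg_cong[of _ _ s])
      moreover have "bij (\<lambda>c. act c (s i))"
        by (rule o_bij[where g = "\<lambda>c. act c (s i)"]) (auto simp: invol fun_eq_iff)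
      then have "(\<Sum>c\<in>UNIV. k (twist act False (Suc i) (insert2 i (act c (s i)) s))) =
          (\<Sum>c\<in>UNIV. k (twist act False (Suc i) (insert2 i c s)))"
        by (rule sum.reindex_bij_betw)
      ultimately show ?thesis unfolding cup_slide using False by simp
    qed
  next
    case (cap_slide i b)
    show ?thesis
    proof (cases b)
      case True
      have "s i = act (s (Suc (Suc i))) (s (Suc i)) \<Longrightarrow>
        delete2 i (twist act True (Suc i) s) = delete2 (Suc i) (twist act False i s)"
        by (auto simp: row_defs fun_eq_iff less_Suc_eq)
      moreover have "act (s i) (s (Suc i)) = s (Suc (Suc i)) \<longleftrightarrow> s i = act (s (Suc (Suc i))) (s (Suc i))"
        by (rule invol_eq)
      ultimately show ?thesis unfolding cap_slide using True by (simp add: twist_def)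
    next
      case False
      have "s i = s (Suc (Suc i)) \<Longrightarrow>
        delete2 i (twist act False (Suc i) s) = delete2 (Suc i) (twist act True i s)"
        by (auto simp: row_defs fun_eq_iff less_Suc_eq)
      then show ?thesis unfolding cap_slide using False by (simp add: twist_def)
    qed
  next
    case (R1 i b)
    \<comment> \<open>For one flag the cap compares \<open>s i\<close> with \<open>c\<close>
      directly; for the other it demands \<open>act (s i) c = c\<close>, which the involution and
      idempotence turn into \<open>s i = c\<close>.\<close>
    have "twist act b i (insert2 (Suc i) c s) (Suc i) = twist act b i (insert2 (Suc i) c s) (Suc (Suc i))
        \<longleftrightarrow> c = s i" for c
      using invol_eq[of "s i" c c] by (auto simp: row_defs idem)
    moreover have "delete2 (Suc i) (twist act b i (insert2 (Suc i) (s i) s)) = s"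
      by (auto simp: row_defs fun_eq_iff idem less_Suc_eq intro!: arg_cong[of _ _ s])
    ultimately show ?thesis unfolding R1 by simp
  next
    case (R2 i b)
    have "twist act (\<not> b) i (twist act b i s) = s"
      by (auto simp: twist_def fun_eq_iff invol)
    then show ?thesis unfolding R2 by simp
  next
    case (R3 i b)
    have "twist act b i (twist act b (Suc i) (twist act b i s)) =
      twist act b (Suc i) (twist act b i (twist act b (Suc i) s))"
      by (auto simp: twist_def fun_eq_iff dist)
    then show ?thesis unfolding R3 by simp
  qed
qed

lemma paint_diagram_move:
  assumes "kei act" "diagram_move D E"
  shows "paint act D = paint act E"
  using assms(2)
proof cases
  case (1 L R U V)
  then have "paint act L = paint act R"
    using paint_local_move[OF assms(1)] by (intro ext) auto
  then show ?thesis
    using 1 by (intro ext) (simp add: paint_append)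
qed

lemma paint_link_equiv:
  assumes "kei act" "link_equiv D E"
  shows "paint act D = paint act E"
  using assms(2) unfolding link_equiv_def
proof (induction rule: equivclp_induct)
  case (step E F)
  then show ?case
    using paint_diagram_move[OF assms(1), of E F] paint_diagram_move[OF assms(1), of F E] by argo
qed (rule refl)

lemma colours_trivial_link: "colours act (trivial_link c) (s :: nat \<Rightarrow> 'a::finite) = card (UNIV :: 'a set) ^ c"
proof -
  have "delete2 0 (insert2 0 x s) = s" "insert2 0 x s 0 = x" "insert2 0 x s (Suc 0) = x" for x and s :: "nat \<Rightarrow> 'a"
    by (auto simp: row_defs)
  then have circle: "paint act [(0, Cup), (0, Cap)] k s = card (UNIV :: 'a set) * k s" for k and s :: "nat \<Rightarrow> 'a"
    by simp
  show ?thesis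
  proof (induction c)
    case (Suc c)
    have "colours act (trivial_link (Suc c)) s = paint act ([(0, Cup), (0, Cap)] @ trivial_link c) (\<lambda>_. 1) s"
      by (simp add: trivial_link_def colours_def)
    also have "\<dots> = card (UNIV :: 'a set) * colours act (trivial_link c) s"
      unfolding paint_append colours_def by (rule circle)
    finally show ?case using Suc by simp
  qed (simp add: trivial_link_def colours_def)
qed

section \<open>Colourings as functions\<close>

fun continues :: "('a \<Rightarrow> 'a \<Rightarrow> 'a) \<Rightarrow> slice \<Rightarrow> (nat \<Rightarrow> 'a) \<Rightarrow> (nat \<Rightarrow> 'a) \<Rightarrow> bool" where
  "continues act (i, Cup) s r \<longleftrightarrow> (\<exists>c. r = insert2 i c s)"
| "continues act (i, Cap) s r \<longleftrightarrow> s i = s (Suc i) \<and> r = delete2 i s"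
| "continues act (i, Cross b) s r \<longleftrightarrow> r = twist act b i s"

text \<open>\<open>paint\<close> only counts; subtracting colourings, or reading off their level
  sets, needs the colourings themselves. \<open>f t\<close> is the row just below slice
  \<open>t\<close>. Rows above the last slice repeat the top row, so that a colouring is one
  function.\<close>

definition colourings :: "('a \<Rightarrow> 'a \<Rightarrow> 'a) \<Rightarrow> slice list \<Rightarrow> (nat \<Rightarrow> 'a) \<Rightarrow> (nat \<Rightarrow> nat \<Rightarrow> 'a) set" where
  "colourings act D s = {f. f 0 = s \<and> (\<forall>t<length D. continues act (D ! t) (f t) (f (Suc t))) \<and>
     (\<forall>t\<ge>length D. f (Suc t) = f t)}"

lemma colourings_Nil: "colourings act [] s = {\<lambda>_. s}"
proof -
  have "f = (\<lambda>_. s)" if "f 0 = s" "\<forall>t. f (Suc t) = f t" for f :: "nat \<Rightarrow> nat \<Rightarrow> 'a"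
  proof
    show "f t = s" for t using that by (induction t) auto
  qed
  then have "{f. f 0 = s \<and> (\<forall>t. f (Suc t) = f t)} = {\<lambda>_. s}" by blast
  then show ?thesis by (simp add: colourings_def)
qed

lemma mem_colourings_Cons:
  "f \<in> colourings act (x # D) s \<longleftrightarrow>
     f 0 = s \<and> continues act x s (f (Suc 0)) \<and> f \<circ> Suc \<in> colourings act D (f (Suc 0))"
proof -
  have "(\<forall>t\<ge>Suc n. f (Suc t) = f t) \<longleftrightarrow> (\<forall>t\<ge>n. f (Suc (Suc t)) = f (Suc t))" for n
    by (metis Suc_le_D Suc_le_mono)
  then show ?thesis
    by (simp add: colourings_def All_less_Suc2) blast
qed

lemma colourings_Cons:
  "colourings act (x # D) s = (\<Union>r\<in>{r. continues act x s r}. case_nat s ` colourings act D r)"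
proof (intro set_eqI iffI)
  fix f assume f: "f \<in> colourings act (x # D) s"
  then have "f = case_nat s (f \<circ> Suc)"
    by (simp add: mem_colourings_Cons fun_eq_iff split: nat.split)
  with f show "f \<in> (\<Union>r\<in>{r. continues act x s r}. case_nat s ` colourings act D r)"
    unfolding mem_colourings_Cons by blast
next
  fix f assume "f \<in> (\<Union>r\<in>{r. continues act x s r}. case_nat s ` colourings act D r)"
  then obtain r g where "continues act x s r" "g \<in> colourings act D r" "f = case_nat s g" by blast
  moreover from this have "f \<circ> Suc = g" "g 0 = r" by (auto simp: colourings_def)
  ultimately show "f \<in> colourings act (x # D) s"
    by (simp add: mem_colourings_Cons)
qed

lemma finite_continues: "finite {r. continues act x s (r :: nat \<Rightarrow> 'a::finite)}"
\<comment> \<open>Only the shape of the slice \<open>x\<close> matters for the case split;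
  \<open>undefined\<close> fills the slot of the upper row.\<close>
proof (cases "(act, x, s, undefined :: nat \<Rightarrow> 'a)" rule: continues.cases)
  case (1 act' i s')
  then have "{r. continues act x s r} = range (\<lambda>c. insert2 i c s)" by auto
  then show ?thesis by simp
qed auto

text \<open>Induction over the slices: colourings that differ in the row above the first slice are
  distinct, so the counts for the possible rows add up.\<close>

lemma card_colourings: "finite (colourings act D s) \<and> card (colourings act D s) = colours act D (s :: nat \<Rightarrow> 'a::finite)"
proof (induction D arbitrary: s)
  case Nil
  then show ?case by (simp add: colourings_Nil colours_def)
next
  case (Cons x D)
  have inj: "inj (case_nat s :: (nat \<Rightarrow> nat \<Rightarrow> 'a) \<Rightarrow> _)"
    by (rule inj_on_inverseI[where g = "\<lambda>f. f \<circ> Suc"]) auto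
  have disj: "case_nat s ` colourings act D r \<inter> case_nat s ` colourings act D r' = {}" if "r \<noteq> r'" for r r'
    using that inj by (auto simp: colourings_def dest: injD)
  have card: "card (colourings act (x # D) s) = (\<Sum>r | continues act x s r. colours act D r)"
    unfolding colourings_Cons using Cons.IH disj
    by (subst card_UN_disjoint) (auto simp: finite_continues card_image inj_on_subset[OF inj])
  have "(\<Sum>r | continues act x s r. colours act D r) = colours act (x # D) s"
  proof (cases "(act, x, s, undefined :: nat \<Rightarrow> 'a)" rule: continues.cases)
    case (1 act' i s')
    then have "{r. continues act x s r} = range (\<lambda>c. insert2 i c s)" by auto
    moreover have "inj (\<lambda>c. insert2 i c s)"
      by (rule inj_on_inverseI[where g = "\<lambda>r. r i"]) (simp add: insert2_def)
    ultimately show ?thesis using 1 by (simp add: sum.reindex colours_def)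
  next
    case (2 act' i s')
    have "{r. continues act x s r} = (if s i = s (Suc i) then {delete2 i s} else {})"
      using 2 by auto
    then show ?thesis using 2 by (simp add: colours_def)
  qed (simp add: colours_def)
  then show ?case
    using card Cons.IH by (simp add: colourings_Cons finite_continues)
qed

section \<open>Moves inside a tangle\<close>

lemma link_equiv_refl: "link_equiv D D"
  by (simp add: link_equiv_def)

lemma link_equiv_trans: "link_equiv D E \<Longrightarrow> link_equiv E F \<Longrightarrow> link_equiv D F"
  unfolding link_equiv_def by (rule equivclp_trans)

lemma width_append: "width m (D @ E) = width (width m D) E"
  by (induction m D rule: width.induct) auto

lemma fits_append: "fits m (D @ E) \<longleftrightarrow> fits m D \<and> fits (width m D) E"
  by (induction m D rule: fits.induct) auto

text \<open>Moves on a diagram with \<open>m\<close> open strands below, in both directions at once.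
  Equal widths at the top let one side replace the other inside a link diagram.\<close>

inductive tangle_move :: "nat \<Rightarrow> slice list \<Rightarrow> slice list \<Rightarrow> bool" for m where
  "local_move L R \<or> local_move R L \<Longrightarrow> fits m (U @ L @ V) \<Longrightarrow> fits m (U @ R @ V) \<Longrightarrow>
     width m (U @ L @ V) = width m (U @ R @ V) \<Longrightarrow> tangle_move m (U @ L @ V) (U @ R @ V)"

definition tangle_equiv :: "nat \<Rightarrow> slice list \<Rightarrow> slice list \<Rightarrow> bool" where
  "tangle_equiv m = (tangle_move m)\<^sup>*\<^sup>*"

lemma link_equiv_tangle_move:
  assumes "tangle_move (width 0 A) D E" "link_diagram (A @ D @ B)"
  shows "link_equiv (A @ D @ B) (A @ E @ B) \<and> link_diagram (A @ E @ B)"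
  using assms(1)
proof cases
  case (1 L R U V)
  have E: "link_diagram (A @ E @ B)"
    using 1 assms(2) unfolding link_diagram_def by (auto simp: fits_append width_append)
  have "diagram_move (A @ D @ B) (A @ E @ B) \<or> diagram_move (A @ E @ B) (A @ D @ B)"
    using diagram_move.intros[of L R "A @ U" "V @ B"] diagram_move.intros[of R L "A @ U" "V @ B"]
      1 E assms(2) by auto
  with E show ?thesis
    unfolding link_equiv_def by (auto intro: r_into_equivclp equivclp_sym)
qed

lemma link_equiv_tangle_equiv:
  assumes "tangle_equiv (width 0 A) D E" "link_diagram (A @ D @ B)"
  shows "link_equiv (A @ D @ B) (A @ E @ B)"
proof -
  have "link_equiv (A @ D @ B) (A @ E @ B) \<and> link_diagram (A @ E @ B)"
    using assms unfolding tangle_equiv_def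
  proof (induction rule: rtranclp_induct)
    case base
    then show ?case by (simp add: link_equiv_refl)
  next
    case (step E F)
    then show ?case using link_equiv_tangle_move link_equiv_trans by blast
  qed
  then show ?thesis ..
qed

section \<open>Executable scripts of local moves\<close>

fun contract :: "slice list \<Rightarrow> slice list" where
  "contract ((i, Cup) # (j, Cap) # D) =
     (if i = Suc j \<or> j = Suc i then D else (i, Cup) # (j, Cap) # D)"
| "contract ((i, Cross a) # (j, Cross b) # D) =
     (if i = j \<and> b = (\<not> a) then D else (i, Cross a) # (j, Cross b) # D)"
| "contract ((i, Cup) # (j, Cross b) # (l, Cap) # D) =
     (if i = Suc j \<and> l = i then D else (i, Cup) # (j, Cross b) # (l, Cap) # D)"
| "contract D = D"

text \<open>Instructions acting at the front of a diagram. \<open>Lower_left\<close> and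
  \<open>Lower_right\<close> bring the second piece below the first when it lies to that side;
  \<open>Slide\<close> moves a strand across an extremum; \<open>Triple\<close> is the third
  Reidemeister move; \<open>Insert\<close> is the inverse of \<open>Cancel\<close>.\<close>

datatype rewrite = Lower_left | Lower_right | Slide | Triple | Cancel | Insert "slice list"

fun apply_rewrite :: "rewrite \<Rightarrow> slice list \<Rightarrow> slice list" where
  "apply_rewrite Lower_left ((j, h) # (i, g) # D) =
     (if i + inputs g \<le> j then (i, g) # (j - inputs g + outputs g, h) # D else (j, h) # (i, g) # D)"
| "apply_rewrite Lower_right ((i, g) # (j, h) # D) =
     (if i + outputs g \<le> j then (j - outputs g + inputs g, h) # (i, g) # D else (i, g) # (j, h) # D)"
| "apply_rewrite Slide ((i, Cup) # (j, Cross b) # D) =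
     (if i = Suc j \<or> j = Suc i then (j, Cup) # (i, Cross (\<not> b)) # D else (i, Cup) # (j, Cross b) # D)"
| "apply_rewrite Slide ((i, Cross b) # (j, Cap) # D) =
     (if i = Suc j \<or> j = Suc i then (j, Cross (\<not> b)) # (i, Cap) # D else (i, Cross b) # (j, Cap) # D)"
| "apply_rewrite Triple ((i, Cross a) # (j, Cross b) # (l, Cross c) # D) =
     (if (i = Suc j \<or> j = Suc i) \<and> l = i \<and> a = b \<and> b = c
      then (j, Cross b) # (i, Cross b) # (j, Cross b) # D
      else (i, Cross a) # (j, Cross b) # (l, Cross c) # D)"
| "apply_rewrite Cancel D = contract D"
| "apply_rewrite (Insert L) D = (if contract L = [] then L @ D else D)"
| "apply_rewrite r D = D"

definition head_move :: "slice list \<Rightarrow> slice list \<Rightarrow> bool" where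
  "head_move D E \<longleftrightarrow> E = D \<or> (\<exists>L R V. D = L @ V \<and> E = R @ V \<and> (local_move L R \<or> local_move R L))"

lemma head_move_refl: "head_move D D"
  by (simp add: head_move_def)

lemma head_move_prefix: "local_move L R \<or> local_move R L \<Longrightarrow> head_move (L @ V) (R @ V)"
  unfolding head_move_def by blast

text \<open>These are the moves with an empty side: zigzags, curls, and pairs of opposite
  crossings.\<close>

lemma contract_cases: "contract D = D \<or> (\<exists>L. D = L @ contract D \<and> local_move L [])"
proof (induction D rule: contract.induct)
  case (1 i j D)
  have "local_move [(i, Cup), (j, Cap)] []" if "i = Suc j \<or> j = Suc i"
    using that zigzag_left[of i] zigzag_right[of j] by auto
  then show ?case by (auto intro!: exI[of _ "[(i, Cup), (j, Cap)]"])
next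
  case (2 i a j b D)
  show ?case using R2[of i a] by (auto intro!: exI[of _ "[(i, Cross a), (j, Cross b)]"])
next
  case (3 i j b l D)
  show ?case using R1[of j b] by (auto intro!: exI[of _ "[(i, Cup), (j, Cross b), (l, Cap)]"])
qed auto

lemma head_move_contract: "head_move D (contract D)"
  using contract_cases[of D] unfolding head_move_def by (metis append_Nil)

text \<open>Soundness of the instructions: each guard is the side condition of the matching move,
  and when it fails the diagram stays as it is.\<close>

lemma head_move_apply_rewrite: "head_move D (apply_rewrite r D)"
proof (induction r D rule: apply_rewrite.induct)
  case (1 j h i g D)
  \<comment> \<open>The guard makes the subtraction \<open>j - inputs g\<close> exact, so it undoes
    the shift in \<open>height\<close>.\<close>
  have "local_move [(i, g), (j - inputs g + outputs g, h)] [(j, h), (i, g)]" if "i + inputs g \<le> j"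
    using that local_move.height[of i "j - inputs g" g h] by simp
  then show ?case
    using head_move_prefix[of "[(j, h), (i, g)]" "[(i, g), (j - inputs g + outputs g, h)]" D]
    by (auto simp: head_move_refl)
next
  case (2 i g j h D)
  have "local_move [(i, g), (j, h)] [(j - outputs g + inputs g, h), (i, g)]" if "i + outputs g \<le> j"
    using that local_move.height[of i "j - outputs g" g h] by simp
  then show ?case
    using head_move_prefix[of "[(i, g), (j, h)]" "[(j - outputs g + inputs g, h), (i, g)]" D]
    by (auto simp: head_move_refl)
next
  case (3 i j b D)
  \<comment> \<open>One instruction covers both directions of the move; the order of
    \<open>i\<close> and \<open>j\<close> decides which one is meant.\<close>
  have "local_move [(i, Cup), (j, Cross b)] [(j, Cup), (i, Cross (\<not> b))] \<or>
      local_move [(j, Cup), (i, Cross (\<not> b))] [(i, Cup), (j, Cross b)]" if "i = Suc j \<or> j = Suc i"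
    using that cup_slide[of i b] cup_slide[of j "\<not> b"] by auto
  then show ?case
    using head_move_prefix[of "[(i, Cup), (j, Cross b)]" "[(j, Cup), (i, Cross (\<not> b))]" D]
    by (simp add: head_move_refl)
next
  case (4 i b j D)
  have "local_move [(i, Cross b), (j, Cap)] [(j, Cross (\<not> b)), (i, Cap)] \<or>
      local_move [(j, Cross (\<not> b)), (i, Cap)] [(i, Cross b), (j, Cap)]" if "i = Suc j \<or> j = Suc i"
    using that cap_slide[of j b] cap_slide[of i "\<not> b"] by auto
  then show ?case
    using head_move_prefix[of "[(i, Cross b), (j, Cap)]" "[(j, Cross (\<not> b)), (i, Cap)]" D]
    by (simp add: head_move_refl)
next
  case (5 i a j b l c D)
  have "local_move [(i, Cross b), (j, Cross b), (i, Cross b)] [(j, Cross b), (i, Cross b), (j, Cross b)] \<or>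
      local_move [(j, Cross b), (i, Cross b), (j, Cross b)] [(i, Cross b), (j, Cross b), (i, Cross b)]"
    if "i = Suc j \<or> j = Suc i"
    using that R3[of i b] R3[of j b] by auto
  then show ?case
    using head_move_prefix[of "[(i, Cross b), (j, Cross b), (i, Cross b)]"
      "[(j, Cross b), (i, Cross b), (j, Cross b)]" D]
    by (auto simp: head_move_refl)
next
  case (6 D)
  show ?case by (simp add: head_move_contract)
next
  case (7 L D)
  show ?case
  proof (cases "contract L = []")
    case True
    then have "L = [] \<or> local_move L []"
      using contract_cases[of L] by auto
    then show ?thesis
      using True head_move_prefix[of "[]" L D] by (auto simp: head_move_refl)
  qed (simp add: head_move_refl)
qed (simp_all add: head_move_refl)

text \<open>A step that does not apply, or that changes the width, leaves the diagram as it is.\<close>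

definition rewrite_step :: "nat \<Rightarrow> nat \<times> rewrite \<Rightarrow> slice list \<Rightarrow> slice list" where
  "rewrite_step m = (\<lambda>(n, r) D.
     let E = take n D @ apply_rewrite r (drop n D)
     in if fits m E \<and> width m E = width m D then E else D)"

text \<open>This reduces an isotopy to the evaluation of a script. Since \<open>rewrite_step\<close>
  checks fit and width itself, every script is sound and only its result has to be computed.\<close>

lemma tangle_equiv_rewrite_steps:
  assumes "fits m D"
  shows "tangle_equiv m D (fold (rewrite_step m) xs D)"
  using assms
proof (induction xs arbitrary: D)
  case Nil
  then show ?case by (simp add: tangle_equiv_def)
next
  case (Cons x xs)
  obtain n r where x: "x = (n, r)" by force
  let ?E = "take n D @ apply_rewrite r (drop n D)"
  have "rewrite_step m x D = D \<or>
    rewrite_step m x D = ?E \<and> fits m ?E \<and> width m ?E = width m D"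
    unfolding x rewrite_step_def by (simp add: Let_def)
  then have "rewrite_step m x D = D \<or> fits m (rewrite_step m x D) \<and> tangle_move m D (rewrite_step m x D)"
  proof (elim disjE)
    assume E: "rewrite_step m x D = ?E \<and> fits m ?E \<and> width m ?E = width m D"
    show ?thesis
    proof (cases "apply_rewrite r (drop n D) = drop n D")
      case True
      then show ?thesis using E by simp
    next
      case False
      then obtain L R V where *: "drop n D = L @ V" "apply_rewrite r (drop n D) = R @ V"
        "local_move L R \<or> local_move R L"
        using head_move_apply_rewrite[of "drop n D" r] unfolding head_move_def by blast
      have "D = take n D @ L @ V"
        using *(1) by (metis append_take_drop_id)
      then show ?thesis
        using tangle_move.intros[OF *(3), of m "take n D" V] E Cons.prems *(2) by simp
    qed
  qed simp
  then show ?case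
    using Cons by (auto simp: tangle_equiv_def intro: converse_rtranclp_into_rtranclp)
qed

lemma link_equiv_rewrite_steps:
  "link_diagram D \<Longrightarrow> fold (rewrite_step 0) xs D = E \<Longrightarrow> link_equiv D E"
  using link_equiv_tangle_equiv[of "[]" D E "[]"] tangle_equiv_rewrite_steps[of 0 D xs]
  by (simp add: link_diagram_def)

section \<open>Composing sequences of crossing changes\<close>

lemma crossing_changes_link_equiv:
  "crossing_changes n D E \<Longrightarrow> link_equiv E F \<Longrightarrow> crossing_changes n D F"
  by (cases rule: crossing_changes.cases, assumption)
     (auto intro: crossing_changes.intros link_equiv_trans)

lemma crossing_changes_trans:
  assumes "crossing_changes m D E" "crossing_changes n E F"
  shows "crossing_changes (m + n) D F"
  using assms(2,1)
  by (induction rule: crossing_changes.induct)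
     (auto intro: crossing_changes_link_equiv crossing_changes.change)

lemma crossing_change_crossing_changes: "crossing_change D E \<Longrightarrow> crossing_changes 1 D E"
  using crossing_changes.change[OF crossing_changes.isotopy[OF link_equiv_refl]] link_equiv_refl by auto

section \<open>Counting components\<close>

lemma fits_nth:
  assumes "fits 0 D" "t < length D" "D ! t = (i, g)"
  shows "i + inputs g \<le> width 0 (take t D)"
    and "width 0 (take (Suc t) D) = width 0 (take t D) - inputs g + outputs g"
proof -
  have "D = take t D @ (i, g) # drop (Suc t) D"
    using assms(2,3) by (metis id_take_nth_drop)
  then have "fits (width 0 (take t D)) ((i, g) # drop (Suc t) D)"
    using assms(1) by (metis fits_append)
  then show "i + inputs g \<le> width 0 (take t D)" by simp
  show "width 0 (take (Suc t) D) = width 0 (take t D) - inputs g + outputs g"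
    using assms(2,3) by (simp add: take_Suc_conv_app_nth width_append)
qed

lemma joined_points:
  assumes "fits 0 D" "joined D p q"
  shows "p \<in> points D \<longleftrightarrow> q \<in> points D"
  using assms(2)
proof cases
  case (left t i g j)
  then show ?thesis using fits_nth[OF assms(1) left(3,4)] by (simp add: points_def)
next
  case (right t i g j)
  then show ?thesis using fits_nth[OF assms(1) right(3,4)] by (auto simp: points_def)
next
  case (cup t i)
  then show ?thesis using fits_nth[OF assms(1) cup(3,4)] by (simp add: points_def)
next
  case (cap t i)
  then show ?thesis using fits_nth[OF assms(1) cap(3,4)] by (simp add: points_def)
next
  case (cross_up t i b)
  then show ?thesis using fits_nth[OF assms(1) cross_up(3,4)] by (simp add: points_def)
next
  case (cross_down t i b)
  then show ?thesis using fits_nth[OF assms(1) cross_down(3,4)] by (simp add: points_def)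
qed

text \<open>These are the unions of components, or the points of one colour in a two-colouring that
  is constant on components.\<close>

definition saturated_sets :: "slice list \<Rightarrow> (nat \<times> nat) set set" where
  "saturated_sets D = {A. A \<subseteq> points D \<and> (\<forall>p q. joined D p q \<longrightarrow> (p \<in> A \<longleftrightarrow> q \<in> A))}"

text \<open>Classes are nonempty and disjoint, so \<open>Union\<close> is injective on sets of
  classes; a saturated set is the union of the classes of its points.\<close>

lemma card_saturated_sets:
  assumes "fits 0 D"
  shows "card (saturated_sets D) = 2 ^ components D"
proof -
  define R where "R = {(p, q). p \<in> points D \<and> q \<in> points D \<and> equivclp (joined D) p q}"
  have "equiv (points D) R"
  proof (rule equivI)
    show "sym R" by (rule symI) (simp add: R_def equivclp_sym)
    show "trans R" unfolding R_def
      by (rule transI) (simp, blast intro: equivclp_trans)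
  qed (auto simp: R_def refl_on_def)
  have "finite (points D)"
    by (rule finite_subset[of _ "SIGMA t:{..length D}. {..<width 0 (take t D)}"]) (auto simp: points_def)
  then have fin: "finite (points D // R)"
    by (rule finite_quotient) (auto simp: R_def)
  have "inj_on Union (Pow (points D // R))"
  proof (rule inj_onI)
    have sub: "S \<subseteq> S'" if S: "S \<subseteq> points D // R" "S' \<subseteq> points D // R" "\<Union> S = \<Union> S'" for S S'
    proof
      fix C assume "C \<in> S"
      then have "C \<noteq> {}"
        using S(1) in_quotient_imp_non_empty[OF \<open>equiv _ R\<close>] by blast
      then obtain p where "p \<in> C" by blast
      then obtain C' where "C' \<in> S'" "p \<in> C'" using \<open>C \<in> S\<close> S(3) by blast
      then have "C = C'"
        using quotient_disj[OF \<open>equiv _ R\<close>, of C C'] \<open>C \<in> S\<close> \<open>p \<in> C\<close> S(1,2) by blast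
      then show "C \<in> S'" using \<open>C' \<in> S'\<close> by simp
    qed
    show "S = S'" if "S \<in> Pow (points D // R)" "S' \<in> Pow (points D // R)" "\<Union> S = \<Union> S'" for S S'
      using that sub[of S S'] sub[of S' S] by auto
  qed
  moreover have "Union ` Pow (points D // R) = saturated_sets D"
  proof (intro equalityI subsetI)
    fix A assume "A \<in> Union ` Pow (points D // R)"
    then obtain S where S: "S \<subseteq> points D // R" "A = \<Union> S" by blast
    have "q \<in> A" if "p \<in> A" "equivclp (joined D) p q" "q \<in> points D" for p q
    proof -
      obtain C where "C \<in> S" "p \<in> C" using S(2) \<open>p \<in> A\<close> by blast
      moreover have "(p, q) \<in> R"
        using that calculation S(1) in_quotient_imp_subset[OF \<open>equiv _ R\<close>, of C] by (auto simp: R_def)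
      ultimately have "q \<in> C"
        using in_quotient_imp_closed[OF \<open>equiv _ R\<close>] S(1) by blast
      then show ?thesis using \<open>C \<in> S\<close> S(2) by blast
    qed
    moreover have "A \<subseteq> points D"
      using S in_quotient_imp_subset[OF \<open>equiv _ R\<close>] by blast
    moreover have "p \<in> A \<longleftrightarrow> q \<in> A" if "joined D p q" for p q
      using calculation that joined_points[OF assms that] r_into_equivclp[of "joined D" p q]
        equivclp_sym[of "joined D" p q] by (meson subsetD)
    ultimately show "A \<in> saturated_sets D"
      unfolding saturated_sets_def by simp
  next
    fix A assume A: "A \<in> saturated_sets D"
    have inv: "q \<in> A" if "equivclp (joined D) p q" "p \<in> A" for p q
      using that
    proof (induction rule: equivclp_induct)
      case (step q r)
      then show ?case
        using A unfolding saturated_sets_def mem_Collect_eq by metis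
    qed
    have "A = (\<Union>p\<in>A. R `` {p})"
    proof (intro equalityI subsetI)
      fix p assume "p \<in> A"
      then show "p \<in> (\<Union>p\<in>A. R `` {p})"
        using A by (auto simp: R_def saturated_sets_def)
    qed (use inv in \<open>auto simp: R_def\<close>)
    moreover have "(\<lambda>p. R `` {p}) ` A \<in> Pow (points D // R)"
      using A by (auto simp: saturated_sets_def intro: quotientI)
    ultimately show "A \<in> Union ` Pow (points D // R)" by blast
  qed
  ultimately have "card (saturated_sets D) = card (Pow (points D // R))"
    by (metis card_image)
  then show ?thesis
    using fin by (simp add: card_Pow components_def R_def)
qed

text \<open>The trivial kei: under strands never change colour, so a colouring is a choice of one
  colour for each component.\<close>

abbreviation keep :: "bool \<Rightarrow> bool \<Rightarrow> bool" where
  "keep \<equiv> \<lambda>x y. x"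

text \<open>Rows are infinite, so the positions beyond the last strand must be shown to stay
  \<open>False\<close>; otherwise they would contribute spurious points.\<close>

lemma continues_False:
  assumes "continues keep (i, g) s r" "\<forall>j\<ge>m. \<not> s j" "i + inputs g \<le> m" "j \<ge> m - inputs g + outputs g"
  shows "\<not> r j"
  using assms by (cases g) (auto simp: insert2_def delete2_def twist_def)

lemma colourings_saturated_sets:
  assumes D: "link_diagram D"
  shows "bij_betw (\<lambda>f. {(t, j). t \<le> length D \<and> f t j})
    (colourings keep D (\<lambda>_. False)) (saturated_sets D)"
proof -
  let ?F = "\<lambda>f :: nat \<Rightarrow> nat \<Rightarrow> bool. {(t, j). t \<le> length D \<and> f t j}"
  \<comment> \<open>The inverse map is the indicator function of \<open>A\<close>. The
    \<open>min\<close> repeats the top row above the last slice, as \<open>colourings\<close>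
    demands.\<close>
  let ?G = "\<lambda>A t j. (min t (length D), j) \<in> A"
  have fits: "fits 0 D" and width: "width 0 D = 0"
    using D by (auto simp: link_diagram_def)
  have "?G (?F f) = f" if f: "f \<in> colourings keep D (\<lambda>_. False)" for f
  proof -
    have stop: "f (Suc t) = f t" if "length D \<le> t" for t
      using f that unfolding colourings_def by blast
    have "f (length D + k) = f (length D)" for k
      by (induction k) (simp_all add: stop)
    then have "f (min t (length D)) = f t" for t
      using le_Suc_ex[of "length D" t] by (cases "t \<le> length D") (auto simp: min_def)
    then show ?thesis by simp
  qed
  moreover have "?F (?G A) = A" if "A \<in> saturated_sets D" for A
    using that by (auto simp: saturated_sets_def points_def min_def)
  moreover have "?F f \<in> saturated_sets D" if f: "f \<in> colourings keep D (\<lambda>_. False)" for f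
  proof -
    have step: "continues keep (D ! t) (f t) (f (Suc t))" if "t < length D" for t
      using f that by (simp add: colourings_def)
    have out: "t \<le> length D \<Longrightarrow> j \<ge> width 0 (take t D) \<Longrightarrow> \<not> f t j" for t j
    proof (induction t arbitrary: j)
      case 0
      then show ?case using f by (simp add: colourings_def)
    next
      case (Suc t)
      obtain i g where g: "D ! t = (i, g)" by force
      show ?case
        using continues_False[of i g "f t" "f (Suc t)" "width 0 (take t D)" j] step[of t] Suc g
          fits_nth[OF fits _ g] by auto
    qed
    have "f (fst p) (snd p) = f (fst q) (snd q) \<and> fst p \<le> length D \<and> fst q \<le> length D"
      if "joined D p q" for p q
      using that
    proof cases
      case (left t i g j)
      then show ?thesis using step[of t] by (cases g) (auto simp: row_defs)
    next
      case (right t i g j)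
      then show ?thesis using step[of t] by (cases g) (auto simp: row_defs)
    next
      case (cup t i)
      then show ?thesis using step[of t] by (auto simp: row_defs)
    next
      case (cap t i)
      then show ?thesis using step[of t] by (auto simp: row_defs)
    next
      case (cross_up t i b)
      then show ?thesis using step[of t] by (auto simp: row_defs)
    next
      case (cross_down t i b)
      then show ?thesis using step[of t] by (auto simp: row_defs)
    qed
    moreover have "?F f \<subseteq> points D"
      using out by (auto simp: points_def intro: leI)
    ultimately show ?thesis
      unfolding saturated_sets_def by (auto simp: case_prod_beta)
  qed
  moreover have "?G A \<in> colourings keep D (\<lambda>_. False)" if A: "A \<in> saturated_sets D" for A
  proof -
    have "continues keep (D ! t) (\<lambda>j. (t, j) \<in> A) (\<lambda>j. (Suc t, j) \<in> A)" if t: "t < length D" for t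
    proof -
      obtain i g where g: "D ! t = (i, g)" by force
      have J: "joined D p q \<Longrightarrow> p \<in> A \<longleftrightarrow> q \<in> A" for p q
        using A unfolding saturated_sets_def by blast
      have l: "(Suc t, j) \<in> A \<longleftrightarrow> (t, j) \<in> A" if "j < i" for j
        using J[OF joined.left[OF t g that]] by simp
      have r: "(Suc t, i + outputs g + j) \<in> A \<longleftrightarrow> (t, i + inputs g + j) \<in> A" for j
        using J[OF joined.right[OF t g]] by simp
      have r': "(Suc t, j) \<in> A \<longleftrightarrow> (t, j - outputs g + inputs g) \<in> A" if "i + outputs g \<le> j" for j
        using r[of "j - outputs g - i"] that by (simp add: algebra_simps)
      have cases: "j < i \<or> j = i \<or> j = Suc i \<or> i + 2 \<le> j" for j by auto
      show ?thesis
      proof (cases g)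
        case Cup
        have "(Suc t, Suc i) \<in> A \<longleftrightarrow> (Suc t, i) \<in> A"
          using J[OF joined.cup[OF t]] g Cup by simp
        then have "(Suc t, j) \<in> A \<longleftrightarrow> insert2 i ((Suc t, i) \<in> A) (\<lambda>j. (t, j) \<in> A) j" for j
          using cases[of j] l[of j] r'[of j] Cup by (elim disjE) (simp_all add: insert2_def)
        then show ?thesis unfolding g Cup continues.simps by blast
      next
        case Cap
        have "(t, Suc i) \<in> A \<longleftrightarrow> (t, i) \<in> A"
          using J[OF joined.cap[OF t]] g Cap by simp
        moreover have "(Suc t, j) \<in> A \<longleftrightarrow> delete2 i (\<lambda>j. (t, j) \<in> A) j" for j
          using l[of j] r'[of j] Cap by (cases "j < i") (simp_all add: delete2_def)
        ultimately show ?thesis unfolding g Cap continues.simps by blast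
      next
        case (Cross b)
        have "(Suc t, Suc i) \<in> A \<longleftrightarrow> (t, i) \<in> A" "(Suc t, i) \<in> A \<longleftrightarrow> (t, Suc i) \<in> A"
          using J[OF joined.cross_up[OF t]] J[OF joined.cross_down[OF t]] g Cross by auto
        moreover have far: "(Suc t, j) \<in> A \<longleftrightarrow> (t, j) \<in> A" if "i + 2 \<le> j" for j
          using le_Suc_ex[OF that] r Cross by auto
        ultimately have "(Suc t, j) \<in> A \<longleftrightarrow> twist keep b i (\<lambda>j. (t, j) \<in> A) j" for j
          using cases[of j] l[of j] far[of j] by (elim disjE) (simp_all add: twist_def)
        then show ?thesis unfolding g Cross continues.simps by blast
      qed
    qed
    moreover have "(0, j) \<notin> A" for j
      using A by (auto simp: saturated_sets_def points_def)
    ultimately show ?thesis by (simp add: colourings_def Suc_le_eq min_absorb1 min_absorb2)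
  qed
  ultimately show ?thesis
    by (intro bij_betw_byWitness[where f' = ?G] ballI image_subsetI)
qed

lemma colours_components:
  assumes "link_diagram D"
  shows "colours keep D (\<lambda>_. False) = 2 ^ components D"
  using bij_betw_same_card[OF colourings_saturated_sets[OF assms]] card_colourings[of keep D]
    card_saturated_sets[of D] assms by (metis link_diagram_def)

lemma kei_fst: "kei keep"
  by (simp add: kei_def)

text \<open>Under the trivial kei the two strands at a crossing merely swap their colours, whichever
  of them passes over.\<close>

lemma paint_fst_crossing_changes:
  "crossing_changes n D E \<Longrightarrow> paint keep D = paint keep E"
proof (induction rule: crossing_changes.induct)
  case (isotopy D E)
  then show ?case using paint_link_equiv kei_fst by blast
next
  case (change n D E E' F)
  have "paint keep E = paint keep E'"
    using change(2)
  proof cases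
    case (1 U i b V)
    have "twist keep b i = twist keep (\<not> b) i"
      by (auto simp: twist_def fun_eq_iff)
    then have "paint keep [(i, Cross b)] = paint keep [(i, Cross (\<not> b))]"
      by (intro ext) (simp only: paint.simps)
    then show ?thesis unfolding 1 by (intro ext) (simp only: paint_append)
  qed
  then show ?case
    using change paint_link_equiv[OF kei_fst, of E' F] by simp
qed

text \<open>Both ends have equally many two-colourings, \<open>2 ^ components D\<close> and
  \<open>2 ^ c\<close>. Hence components never have to be counted from the classes of
  points.\<close>

lemma components_crossing_changes:
  assumes "link_diagram D" "crossing_changes n D (trivial_link c)"
  shows "components D = c"
  using colours_components[OF assms(1)] paint_fst_crossing_changes[OF assms(2)]
    colours_trivial_link[of keep c "\<lambda>_. False"] by (simp add: colours_def)

lemma unknotting_number_le: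
  assumes "link_diagram D" "crossing_changes n D (trivial_link c)"
  shows "unknotting_number D \<le> n"
  unfolding unknotting_number_def components_crossing_changes[OF assms]
  by (rule Least_le) (rule assms)

section \<open>Fox colourings\<close>

text \<open>Reflection of \<open>x\<close> in \<open>y\<close>. This is the Fox relation: twice the
  over colour equals the sum of the two under colours.\<close>

definition dihedral :: "'a::ab_group_add \<Rightarrow> 'a \<Rightarrow> 'a" where
  "dihedral x y = y + y - x"

lemma kei_dihedral: "kei dihedral"
  by (simp add: kei_def dihedral_def algebra_simps)

text \<open>The conditions at all pieces are linear, so the colourings with bottom row 0 form a
  group.\<close>

lemma colourings_dihedral_diff:
  assumes "f \<in> colourings dihedral D (\<lambda>_. 0 :: 'a::ab_group_add)" "g \<in> colourings dihedral D (\<lambda>_. 0)"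
  shows "(\<lambda>t j. f t j - g t j) \<in> colourings dihedral D (\<lambda>_. 0)"
proof -
  have "continues dihedral x (\<lambda>j. s j - s' j) (\<lambda>j. r j - r' j)"
    if "continues dihedral x s r" "continues dihedral x s' r'" for x and s s' r r' :: "nat \<Rightarrow> 'a"
  proof -
    have "(\<lambda>j. insert2 i c s j - insert2 i c' s' j) = insert2 i (c - c') (\<lambda>j. s j - s' j)" for i c c'
      by (auto simp: insert2_def)
    moreover have "(\<lambda>j. delete2 i s j - delete2 i s' j) = delete2 i (\<lambda>j. s j - s' j)" for i
      by (auto simp: delete2_def)
    moreover have "(\<lambda>j. twist dihedral b i s j - twist dihedral b i s' j) = twist dihedral b i (\<lambda>j. s j - s' j)" for b i
      by (auto simp: twist_def dihedral_def fun_eq_iff)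
    ultimately show ?thesis
      using that by (cases x; cases "snd x") auto
  qed
  then show ?thesis
    using assms by (simp add: colourings_def)
qed

text \<open>Sort the colourings by the difference \<open>d\<close> of the two colours entering the
  crossing. Subtracting a fixed member maps the class of \<open>d\<close> injectively into the class
  of 0. There both flags impose the same relation, since a colour acts trivially on itself.\<close>

lemma colours_dihedral_crossing:
  "colours dihedral (U @ [(i, Cross b)] @ V) (\<lambda>_. 0 :: 'a::{ab_group_add, finite}) \<le>
     card (UNIV :: 'a set) * colours dihedral (U @ [(i, Cross (\<not> b))] @ V) (\<lambda>_. 0 :: 'a)"
proof -
  define A where "A b = colourings dihedral (U @ [(i, Cross b)] @ V) (\<lambda>_. 0 :: 'a)" for b
  define B where "B d = {f \<in> A b. f (length U) i - f (length U) (Suc i) = d}" for d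
  have fin: "finite (A b)" for b
    using card_colourings unfolding A_def by blast
  have "card (B d) \<le> card (B 0)" for d
  proof (cases "B d = {}")
    case False
    then obtain g where g: "g \<in> B d" by blast
    show ?thesis
    proof (rule card_inj_on_le)
      show "inj_on (\<lambda>f t j. f t j - g t j) (B d)"
        by (rule inj_onI) (simp add: fun_eq_iff)
      show "(\<lambda>f t j. f t j - g t j) ` B d \<subseteq> B 0"
        using g by (auto simp: A_def B_def colourings_dihedral_diff algebra_simps)
      show "finite (B 0)" using fin by (simp add: B_def)
    qed
  qed simp
  moreover have "A b = (\<Union>d. B d)" by (auto simp: B_def)
  then have "card (A b) \<le> (\<Sum>d\<in>UNIV. card (B d))"
    by (simp add: card_UN_le)
  ultimately have "card (A b) \<le> (\<Sum>d\<in>(UNIV :: 'a set). card (B 0))"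
    by (meson order_trans sum_mono)
  also have "\<dots> = card (UNIV :: 'a set) * card (B 0)"
    by simp
  also have "card (B 0) \<le> card (A (\<not> b))"
  proof (rule card_mono[OF fin], rule)
    fix f assume f: "f \<in> B 0"
    let ?s = "f (length U)"
    have "?s i = ?s (Suc i)" using f by (simp add: B_def)
    moreover have "dihedral x x = x" for x :: 'a by (simp add: dihedral_def)
    ultimately have eq: "twist dihedral b i ?s = twist dihedral (\<not> b) i ?s"
      by (auto simp: twist_def)
    have "continues dihedral ((U @ [(i, Cross (\<not> b))] @ V) ! t) (f t) (f (Suc t))"
      if "t < length (U @ [(i, Cross b)] @ V)" for t
    proof (cases "t = length U")
      case True
      then show ?thesis
        using f that eq by (auto simp: A_def B_def colourings_def dest: spec[of _ "length U"])
    next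
      case False
      then have "(U @ [(i, Cross (\<not> b))] @ V) ! t = (U @ [(i, Cross b)] @ V) ! t"
        by (simp add: nth_append nth_Cons')
      then show ?thesis
        using f that by (simp add: A_def B_def colourings_def)
    qed
    then show "f \<in> A (\<not> b)"
      using f by (simp add: A_def B_def colourings_def)
  qed
  finally show ?thesis
    using card_colourings[of dihedral _ "\<lambda>_. 0 :: 'a"] by (simp add: A_def)
qed

lemma colours_dihedral_crossing_changes:
  "crossing_changes n D E \<Longrightarrow>
     colours dihedral D (\<lambda>_. 0 :: 'a::{ab_group_add, finite}) \<le>
       card (UNIV :: 'a set) ^ n * colours dihedral E (\<lambda>_. 0 :: 'a)"
proof (induction rule: crossing_changes.induct)
  case (isotopy D E)
  then have "colours dihedral D (\<lambda>_. 0 :: 'a) = colours dihedral E (\<lambda>_. 0 :: 'a)"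
    using paint_link_equiv[OF kei_dihedral[where 'a = 'a]] by (simp add: colours_def)
  then show ?case by simp
next
  case (change n D E E' F)
  let ?q = "card (UNIV :: 'a set)"
  have "colours dihedral E (\<lambda>_. 0 :: 'a) \<le> ?q * colours dihedral E' (\<lambda>_. 0 :: 'a)"
    using change(2) by cases (simp only: colours_dihedral_crossing)
  also have "colours dihedral E' (\<lambda>_. 0 :: 'a) = colours dihedral F (\<lambda>_. 0 :: 'a)"
    using paint_link_equiv[OF kei_dihedral[where 'a = 'a] change(3)] by (simp add: colours_def)
  finally have "colours dihedral E (\<lambda>_. 0 :: 'a) \<le> ?q * colours dihedral F (\<lambda>_. 0 :: 'a)" .
  then have "?q ^ n * colours dihedral E (\<lambda>_. 0 :: 'a) \<le> ?q ^ n * (?q * colours dihedral F (\<lambda>_. 0 :: 'a))"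
    by (rule mult_left_mono) simp
  from order_trans[OF change.IH this] show ?case by (simp only: power_Suc mult_ac)
qed

section \<open>Closures of 4-braids\<close>

lemma link_diagram_closure:
  assumes "\<forall>(i, b)\<in>set w. 1 \<le> i \<and> i \<le> 3"
  shows "link_diagram (braid_closure 4 w)"
proof -
  \<comment> \<open>Eight strands: four of the braid and four closing arcs to its right.\<close>
  have "fits 8 (braid_slices w) \<and> width 8 (braid_slices w) = 8"
    using assms by (induction w) (auto simp: braid_slices_def)
  moreover have "fits 0 (map (\<lambda>i. (i, Cup)) [0..<4]) \<and> width 0 (map (\<lambda>i. (i, Cup)) [0..<4]) = 8"
    by code_simp
  moreover have "fits 8 (map (\<lambda>i. (i, Cap)) (rev [0..<4])) \<and> width 8 (map (\<lambda>i. (i, Cap)) (rev [0..<4])) = 0"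
    by code_simp
  ultimately show ?thesis
    by (simp only: link_diagram_def braid_closure_def tangle_closure_def fits_append width_append simp_thms)
qed

lemma braid_slices_append: "braid_slices (v @ w) = braid_slices v @ braid_slices w"
  by (simp add: braid_slices_def)

lemma braid_closure_append:
  "braid_closure 4 (u @ v @ w) =
     (map (\<lambda>i. (i, Cup)) [0..<4] @ braid_slices u) @ braid_slices v @
     (braid_slices w @ map (\<lambda>i. (i, Cap)) (rev [0..<4]))"
  by (simp add: braid_closure_def tangle_closure_def braid_slices_append)

text \<open>Each letter whose sign differs costs one crossing change. The prefix \<open>u\<close> is
  arbitrary in the induction so that treated letters can be moved into it.\<close>

lemma crossing_changes_braid_closure:
  assumes "map fst v = map fst v'" "\<forall>(i, b)\<in>set (u @ v @ w). 1 \<le> i \<and> i \<le> 3"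
  shows "crossing_changes (length (filter (\<lambda>(x, y). x \<noteq> y) (zip v v')))
    (braid_closure 4 (u @ v @ w)) (braid_closure 4 (u @ v' @ w))"
  using assms
proof (induction v arbitrary: u v')
  case Nil
  then show ?case by (simp add: crossing_changes.isotopy link_equiv_refl)
next
  case (Cons x v)
  obtain i b where x: "x = (i, b)" by force
  obtain b' v'' where v': "v' = (i, b') # v''" "map fst v = map fst v''"
    using Cons.prems(1) x by (cases v') auto
  let ?n = "length (filter (\<lambda>(x, y). x \<noteq> y) (zip v v''))"
  have rest: "crossing_changes ?n (braid_closure 4 (u @ ((i, b') # v) @ w)) (braid_closure 4 (u @ v' @ w))"
    using Cons.IH[OF v'(2), of "u @ [(i, b')]"] Cons.prems(2) v'(1) x by simp
  show ?case
  proof (cases "b = b'")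
    case True
    then show ?thesis using rest by (simp add: x v'(1))
  next
    case False
    have split: "braid_closure 4 (u @ ((i, c) # v) @ w) =
      (map (\<lambda>i. (i, Cup)) [0..<4] @ braid_slices u) @ [(i - 1, Cross c)] @
      (braid_slices (v @ w) @ map (\<lambda>i. (i, Cap)) (rev [0..<4]))" for c
      using braid_closure_append[of u "(i, c) # v" w] by (simp add: braid_slices_def)
    have "crossing_change (braid_closure 4 (u @ ((i, b) # v) @ w)) (braid_closure 4 (u @ ((i, \<not> b) # v) @ w))"
      using link_diagram_closure[OF Cons.prems(2)] unfolding x split by (rule crossing_change.intros)
    moreover have "b' = (\<not> b)" using False by simp
    ultimately have "crossing_changes (1 + ?n) (braid_closure 4 (u @ (x # v) @ w)) (braid_closure 4 (u @ v' @ w))"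
      using crossing_changes_trans[OF crossing_change_crossing_changes rest] x by simp
    then show ?thesis using False by (simp add: x v'(1))
  qed
qed

text \<open>Strand 0 crosses over all others, strand 1 over strands 2 and 3, and strand 2 over
  strand 3, so this pure braid lies in layers. The width 8 includes the closing arcs.\<close>

lemma stacked_braid_trivial:
  "fold (rewrite_step 8)
    [(2, Lower_left), (5, Lower_left), (8, Lower_left), (0, Triple), (2, Triple), (4, Lower_left),
     (5, Cancel), (1, Lower_right), (2, Triple), (4, Cancel), (3, Cancel), (0, Triple),
     (2, Cancel), (1, Cancel), (0, Cancel)]
    (braid_slices [sigma 1, sigma 2, sigma 3, sigma 1, sigma 2, sigma_inv 3,
       sigma 1, sigma_inv 2, sigma_inv 3, sigma_inv 1, sigma_inv 2, sigma_inv 3]) = []"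
  by code_simp

text \<open>Four nested circles: inserted pairs of opposite crossings let inner circles slip out
  across the enclosing arcs.\<close>

lemma closure_0:
  "fold (rewrite_step 0)
    [(4, Insert [(2, Cross True), (2, Cross False)]), (3, Slide), (5, Slide), (4, Cancel),
     (4, Insert [(1, Cross True), (1, Cross False)]), (3, Slide), (5, Slide), (4, Cancel),
     (4, Insert [(0, Cross True), (0, Cross False)]), (3, Slide), (5, Slide), (4, Cancel),
     (4, Lower_right), (5, Lower_right), (6, Lower_right), (3, Lower_right), (4, Lower_right),
     (5, Lower_right), (3, Insert [(1, Cross True), (1, Cross False)]), (2, Slide), (4, Slide),
     (3, Cancel), (3, Insert [(0, Cross True), (0, Cross False)]), (2, Slide), (4, Slide),
     (3, Cancel), (3, Lower_right), (4, Lower_right), (2, Lower_right), (3, Lower_right),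
     (2, Insert [(0, Cross True), (0, Cross False)]), (1, Slide), (3, Slide), (2, Cancel),
     (2, Lower_right), (1, Lower_right)]
    (braid_closure 4 []) = trivial_link 4"
  by code_simp

text \<open>Three Markov destabilisations: each \<open>Cancel\<close> removes a curl.\<close>

lemma closure_1:
  "fold (rewrite_step 0)
    [(3, Lower_left), (4, Lower_left), (5, Cancel), (2, Lower_left), (3, Cancel), (1, Cancel)]
    (braid_closure 4 [sigma 1, sigma 2, sigma_inv 3]) = trivial_link 1"
  by code_simp

text \<open>The square of the word with one sign changed, that of the second
  \<open>sigma 2\<close>.\<close>

lemma closure_2:
  "fold (rewrite_step 0)
    [(6, Lower_left), (4, Triple), (9, Insert [(2, Cross False), (2, Cross True)]), (7, Triple),
     (6, Cancel), (8, Cancel), (7, Lower_right), (8, Slide), (9, Lower_right), (8, Slide),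
     (7, Lower_right), (6, Lower_right), (5, Lower_right), (4, Lower_right), (3, Lower_right),
     (2, Slide), (1, Lower_right), (2, Slide), (3, Lower_right), (4, Cancel), (3, Lower_left),
     (4, Cancel), (2, Lower_left), (4, Insert [(1, Cross True), (1, Cross False)]), (3, Slide),
     (5, Slide), (4, Cancel), (4, Insert [(0, Cross True), (0, Cross False)]), (3, Slide),
     (5, Slide), (4, Cancel), (4, Lower_right), (5, Lower_right), (3, Lower_right),
     (4, Lower_right), (1, Cancel)]
    (braid_closure 4 [sigma 1, sigma 2, sigma_inv 3, sigma 1, sigma_inv 2, sigma_inv 3]) = trivial_link 2"
  by code_simp

text \<open>These are the first nine letters of the layered braid above; they differ from the cube
  of the word in two signs.\<close>

lemma closure_3:
  "fold (rewrite_step 0)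
    [(6, Lower_left), (9, Lower_left), (4, Triple), (6, Triple), (8, Lower_left), (9, Cancel),
     (5, Lower_right), (6, Triple), (8, Cancel), (4, Triple), (6, Lower_left), (7, Cancel),
     (6, Lower_right), (5, Lower_right), (3, Cancel), (4, Lower_right), (2, Cancel), (1, Cancel)]
    (braid_closure 4 [sigma 1, sigma 2, sigma 3, sigma 1, sigma 2, sigma_inv 3,
       sigma 1, sigma_inv 2, sigma_inv 3]) = trivial_link 1"
  by code_simp

text \<open>A third Reidemeister move at \<open>\<sigma>\<^sub>1 \<sigma>\<^sub>2 \<sigma>\<^sub>1\<close> leaves only two letters \<open>\<sigma>\<^sub>1\<close>, which form a clasp on the
  outer face.  Up to planar isotopy, it remains to swing an outermost arc of the diagram twice
  over everything else to the opposite side.  The list comes from a computer search.\<close>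

lemma closure_9_47:
  "fold (rewrite_step 0)
    [(3, Lower_left), (4, Lower_left), (6, Lower_left), (9, Lower_left), (2, Lower_left),
     (5, Lower_left), (2, Lower_right), (3, Triple), (2, Slide), (1, Lower_left), (3, Lower_left),
     (2, Lower_left), (3, Slide), (4, Lower_left), (5, Lower_left), (6, Lower_left),
     (7, Lower_left), (8, Lower_left), (9, Lower_left), (10, Lower_left), (11, Lower_left),
     (12, Lower_left), (5, Slide), (6, Lower_left), (7, Lower_left),
     (16, Insert [(2, Cup), (1, Cross True), (2, Cap)]), (16, Slide), (18, Lower_left),
     (17, Lower_left), (16, Cancel), (15, Insert [(2, Cross False), (2, Cross True)]), (16, Slide),
     (17, Lower_left), (14, Lower_right), (15, Insert [(3, Cross False), (3, Cross True)]),
     (16, Slide), (17, Lower_left), (18, Lower_left),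
     (16, Insert [(4, Cross False), (4, Cross True)]), (14, Triple), (13, Cancel),
     (15, Lower_left), (16, Lower_left), (17, Lower_left), (12, Lower_right), (13, Lower_right),
     (14, Insert [(4, Cross False), (4, Cross True)]), (15, Slide), (16, Lower_left),
     (17, Lower_left), (18, Lower_left), (11, Lower_right), (12, Lower_right), (13, Lower_right),
     (14, Triple), (16, Lower_left), (17, Lower_left), (10, Lower_right), (11, Lower_right),
     (12, Lower_right), (13, Lower_right), (17, Insert [(2, Cross False), (2, Cross True)]),
     (15, Triple), (14, Cancel), (16, Lower_left), (9, Lower_right), (10, Lower_right),
     (11, Lower_right), (12, Triple), (14, Lower_left), (15, Lower_left), (8, Lower_right),
     (9, Lower_right), (13, Insert [(4, Cross False), (4, Cross True)]), (11, Triple),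
     (10, Cancel), (12, Lower_left), (13, Lower_left), (14, Lower_left), (7, Lower_right),
     (8, Lower_right), (9, Lower_right), (10, Lower_right), (11, Lower_right),
     (15, Insert [(1, Cross False), (1, Cross True)]), (13, Triple), (12, Cancel),
     (6, Lower_right), (7, Lower_right), (8, Lower_right), (9, Lower_right),
     (13, Insert [(2, Cross False), (2, Cross True)]), (11, Triple), (10, Cancel),
     (12, Lower_left), (5, Lower_right), (6, Lower_right), (7, Lower_right), (8, Slide),
     (9, Cancel), (8, Lower_left), (9, Lower_left), (4, Lower_right), (5, Lower_right),
     (9, Insert [(2, Cross False), (2, Cross True)]), (7, Triple), (6, Cancel), (8, Lower_left),
     (3, Lower_right), (4, Slide), (5, Cancel), (4, Lower_left), (5, Lower_left), (2, Lower_right),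
     (6, Insert [(1, Cross False), (1, Cross True)]), (4, Triple), (3, Cancel), (1, Slide),
     (2, Cancel), (1, Lower_left), (1, Insert [(2, Cup), (1, Cross False), (2, Cap)]), (2, Slide),
     (0, Lower_right), (1, Lower_right), (2, Cancel), (1, Cancel), (15, Lower_left),
     (14, Lower_left), (13, Lower_left), (12, Lower_left), (11, Lower_left), (10, Lower_left),
     (9, Lower_left), (8, Lower_left), (7, Slide), (6, Lower_left), (5, Lower_left),
     (4, Lower_left), (3, Lower_left), (3, Insert [(1, Cup), (2, Cap)]), (4, Lower_left),
     (3, Slide), (2, Lower_left), (3, Lower_left), (1, Lower_left), (2, Lower_left),
     (0, Lower_left), (14, Slide), (13, Lower_right), (14, Slide), (15, Lower_right),
     (16, Lower_right), (17, Lower_right), (1, Insert [(0, Cross True), (0, Cross False)]),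
     (2, Insert [(0, Cup), (1, Cap)]), (1, Lower_left), (0, Lower_left), (2, Slide), (1, Cancel),
     (1, Lower_right), (2, Insert [(1, Cross True), (1, Cross False)]), (1, Slide),
     (3, Insert [(0, Cross True), (0, Cross False)]), (4, Triple), (6, Cancel), (2, Lower_left),
     (5, Lower_right), (4, Lower_right), (3, Lower_right),
     (4, Insert [(3, Cross True), (3, Cross False)]), (3, Slide), (8, Lower_right),
     (7, Lower_right), (5, Insert [(2, Cross True), (2, Cross False)]), (6, Triple), (8, Cancel),
     (4, Lower_left), (9, Lower_right), (8, Slide), (7, Cancel), (6, Lower_left), (5, Lower_left),
     (8, Lower_right), (7, Lower_right), (8, Insert [(2, Cross True), (2, Cross False)]),
     (7, Slide), (6, Lower_left), (11, Lower_right),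
     (9, Insert [(1, Cross True), (1, Cross False)]), (10, Triple), (12, Cancel), (8, Lower_left),
     (7, Lower_left), (12, Lower_right), (11, Lower_right),
     (12, Insert [(2, Cross True), (2, Cross False)]), (11, Slide), (10, Lower_left),
     (9, Lower_left), (8, Lower_left), (15, Lower_right),
     (13, Insert [(1, Cross True), (1, Cross False)]), (14, Triple), (16, Cancel),
     (12, Lower_left), (11, Lower_left), (10, Lower_left), (9, Lower_left), (16, Slide),
     (15, Cancel), (14, Lower_left), (13, Lower_left), (12, Lower_left), (11, Lower_left),
     (10, Lower_left), (15, Lower_right), (13, Insert [(1, Cross True), (1, Cross False)]),
     (14, Triple), (16, Cancel), (12, Lower_left), (11, Lower_left), (15, Triple),
     (14, Lower_left), (13, Lower_left), (12, Lower_left), (17, Lower_right),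
     (15, Insert [(1, Cross True), (1, Cross False)]), (16, Triple), (18, Cancel),
     (14, Lower_left), (13, Lower_left), (17, Triple), (16, Lower_left), (15, Lower_left),
     (14, Lower_left), (19, Lower_right), (18, Lower_right), (17, Lower_right),
     (15, Insert [(3, Cross True), (3, Cross False)]), (16, Triple), (18, Cancel),
     (20, Lower_right), (19, Lower_right), (18, Slide), (17, Cancel), (16, Lower_left),
     (19, Lower_right), (18, Slide), (17, Cancel), (18, Insert [(1, Cup), (0, Cap)]),
     (19, Lower_right), (20, Lower_right), (18, Slide), (18, Cancel), (8, Slide), (9, Lower_left),
     (8, Cancel), (13, Slide), (14, Lower_left), (13, Slide), (2, Lower_right), (1, Lower_right),
     (5, Lower_right), (4, Lower_right), (3, Lower_right), (2, Lower_right)]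
    (braid_closure 4 (braid_power [sigma 1, sigma 2, sigma_inv 3] 3)) = knot_9_47"
  by code_simp

lemma colours_closure_3:
  "colours dihedral (braid_closure 4 (braid_power [sigma 1, sigma 2, sigma_inv 3] 3))
     (\<lambda>_. 0 :: Enum.finite_3) = 27"
proof -
  have closure: "braid_closure 4 (braid_power [sigma 1, sigma 2, sigma_inv 3] 3) =
    [(0, Cup), (1, Cup), (2, Cup), (3, Cup),
     (0, Cross True), (1, Cross True), (2, Cross False),
     (0, Cross True), (1, Cross True), (2, Cross False),
     (0, Cross True), (1, Cross True), (2, Cross False),
     (3, Cap), (2, Cap), (1, Cap), (0, Cap)]"
    by code_simp
  show ?thesis
    \<comment> \<open>The four cups give a sum over 81 colour choices, evaluated outright. The
      bottom row 0 stays to the right of all strands and imposes no condition.\<close>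
    unfolding closure by (simp add: colours_def row_defs, unfold UNIV_finite_3, code_simp)
qed

text \<open>Induction in steps of four, down to the exponents 0 to 3. The braid permutes its strands
  by a 4-cycle, whose \<open>q\<close>-th power has \<open>gcd 4 q\<close> cycles; this is the
  number of components.\<close>

lemma crossing_changes_closure:
  "crossing_changes (if 4 dvd q then q else q - 1)
     (braid_closure 4 (braid_power [sigma 1, sigma 2, sigma_inv 3] q)) (trivial_link (gcd 4 q))"
proof (induction q rule: less_induct)
  case (less q)
  let ?w = "[sigma 1, sigma 2, sigma_inv 3]"
  consider "q = 0" | "q = 1" | "q = 2" | "q = 3" | r where "q = r + 4"
  proof -
    have "q < 4 \<Longrightarrow> q = 0 \<or> q = 1 \<or> q = 2 \<or> q = 3" by linarith
    moreover have "\<not> q < 4 \<Longrightarrow> q = (q - 4) + 4" by simp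
    ultimately show ?thesis using that by blast
  qed
  then show ?case
  proof cases
    case 1
    then show ?thesis
      using link_equiv_rewrite_steps[OF _ closure_0] link_diagram_closure[of "[]"]
      by (simp add: braid_power_def crossing_changes.isotopy)
  next
    case 2
    have "link_equiv (braid_closure 4 (braid_power ?w 1)) (trivial_link 1)"
      using link_equiv_rewrite_steps[OF _ closure_1] link_diagram_closure[of ?w]
      by (simp add: braid_power_def)
    then show ?thesis using 2 by (simp add: crossing_changes.isotopy)
  next
    case 3
    let ?v = "[sigma 1, sigma 2, sigma_inv 3, sigma 1, sigma_inv 2, sigma_inv 3]"
    have "crossing_changes 1 (braid_closure 4 (braid_power ?w 2)) (braid_closure 4 ?v)"
      using crossing_changes_braid_closure[of "braid_power ?w 2" ?v "[]" "[]"]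
      by (simp add: braid_power_def numeral_2_eq_2)
    moreover have "link_equiv (braid_closure 4 ?v) (trivial_link 2)"
      using link_equiv_rewrite_steps[OF _ closure_2] link_diagram_closure[of ?v] by simp
    ultimately show ?thesis
      using 3 crossing_changes_link_equiv by simp
  next
    case 4
    let ?v = "[sigma 1, sigma 2, sigma 3, sigma 1, sigma 2, sigma_inv 3, sigma 1, sigma_inv 2, sigma_inv 3]"
    have "crossing_changes 2 (braid_closure 4 (braid_power ?w 3)) (braid_closure 4 ?v)"
      using crossing_changes_braid_closure[of "braid_power ?w 3" ?v "[]" "[]"]
      by (simp add: braid_power_def numeral_3_eq_3 numeral_2_eq_2)
    moreover have "link_equiv (braid_closure 4 ?v) (trivial_link 1)"
      using link_equiv_rewrite_steps[OF _ closure_3] link_diagram_closure[of ?v] by simp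
    moreover have "gcd 4 (3::nat) = 1" by code_simp
    ultimately show ?thesis
      using 4 crossing_changes_link_equiv by simp
  next
    case (5 r)
    let ?n = "if 4 dvd r then r else r - 1"
    let ?v = "[sigma 1, sigma 2, sigma 3, sigma 1, sigma 2, sigma_inv 3,
       sigma 1, sigma_inv 2, sigma_inv 3, sigma_inv 1, sigma_inv 2, sigma_inv 3]"
    let ?x = "braid_power ?w r"
    have x: "\<forall>(i, b)\<in>set ?x. 1 \<le> i \<and> i \<le> 3"
      by (auto simp: braid_power_def)
    have power: "braid_power ?w q = braid_power ?w 4 @ ?x"
      unfolding 5 by (simp add: braid_power_def add.commute[of r] replicate_add)
    have w4: "braid_power ?w 4 = ?w @ ?w @ ?w @ ?w"
      by (simp add: braid_power_def numeral_eq_Suc)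
    \<comment> \<open>The fourth power and the layered braid \<open>?v\<close> differ in the signs
      of letters 3, 8, 10 and 11.\<close>
    have "crossing_changes 4 (braid_closure 4 (braid_power ?w q)) (braid_closure 4 (?v @ ?x))"
      using crossing_changes_braid_closure[of "braid_power ?w 4" ?v "[]" ?x] x
      unfolding power w4 by (simp add: numeral_eq_Suc)
    moreover have "link_equiv (braid_closure 4 (?v @ ?x)) (braid_closure 4 ?x)"
    proof -
      have "width 0 (map (\<lambda>i. (i, Cup)) [0..<4] @ braid_slices []) = 8" by code_simp
      moreover have "fits 8 (braid_slices ?v)" by code_simp
      then have "tangle_equiv 8 (braid_slices ?v) []"
        using tangle_equiv_rewrite_steps stacked_braid_trivial by metis
      moreover have "link_diagram (braid_closure 4 ([] @ ?v @ ?x))"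
        using x by (intro link_diagram_closure) auto
      ultimately have "link_equiv (braid_closure 4 ([] @ ?v @ ?x)) (braid_closure 4 ([] @ [] @ ?x))"
        unfolding braid_closure_append[of "[]"]
        using link_equiv_tangle_equiv braid_slices_def by (metis list.map(1))
      then show ?thesis by simp
    qed
    moreover have "crossing_changes ?n (braid_closure 4 ?x) (trivial_link (gcd 4 r))"
      using less 5 by simp
    ultimately have "crossing_changes (4 + ?n) (braid_closure 4 (braid_power ?w q)) (trivial_link (gcd 4 r))"
      using crossing_changes_trans crossing_changes_link_equiv by blast
    moreover have "4 dvd q \<longleftrightarrow> 4 dvd r"
      unfolding 5 by simp
    \<comment> \<open>The term \<open>r - 1\<close> occurs only when 4 does not divide
      \<open>r\<close>; then \<open>r\<close> is positive and the subtraction is exact.\<close>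
    then have "4 + ?n = (if 4 dvd q then q else q - 1)"
      using 5 by (cases "r = 0") auto
    moreover have "gcd 4 r = gcd 4 q"
      using gcd_add2[of 4 r] by (simp add: 5 add.commute)
    ultimately show ?thesis by simp
  qed
qed

section \<open>The bound for all exponents and its sharpness at exponent 3\<close>

theorem mainTheorem6:
  fixes K :: "nat \<Rightarrow> slice list"
  defines "K \<equiv> \<lambda>q. braid_closure 4 (braid_power [sigma 1, sigma 2, sigma_inv 3] q)"
  shows "(\<forall>q\<ge>1. unknotting_number (K q) \<le> (if 4 dvd q then q else q - 1)) \<and>
         link_equiv (K 3) knot_9_47 \<and> unknotting_number (K 3) = 2"
proof -
  have diagram: "link_diagram (K q)" for q
    unfolding K_def by (rule link_diagram_closure) (auto simp: braid_power_def)
  have changes: "crossing_changes (if 4 dvd q then q else q - 1) (K q) (trivial_link (gcd 4 q))" for q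
    unfolding K_def by (rule crossing_changes_closure)
  have le: "unknotting_number (K q) \<le> (if 4 dvd q then q else q - 1)" for q
    using unknotting_number_le[OF diagram changes] .
  have "gcd 4 (3::nat) = 1" by code_simp
  then have "crossing_changes 2 (K 3) (trivial_link 1)"
    using changes[of 3] by simp
  moreover from this have "components (K 3) = 1"
    using components_crossing_changes diagram by blast
  \<comment> \<open>A sequence of two changes exists, so the minimum is attained and the colouring
    bound applies to a shortest sequence.\<close>
  ultimately have "crossing_changes (unknotting_number (K 3)) (K 3) (trivial_link 1)"
    unfolding unknotting_number_def by (metis LeastI)
  from colours_dihedral_crossing_changes[OF this, where 'a = Enum.finite_3]
  moreover have card: "card (UNIV :: Enum.finite_3 set) = 3"
    by (simp add: UNIV_finite_3)
  ultimately have "27 \<le> 3 ^ unknotting_number (K 3) * (3 :: nat)"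
    unfolding K_def colours_closure_3 colours_trivial_link card power_one_right by blast
  \<comment> \<open>Cancelling the 3 colourings of the unknot leaves 9 as a lower bound for the
    power of 3.\<close>
  then have "3 ^ 2 \<le> (3 :: nat) ^ unknotting_number (K 3)"
    by simp
  then have "2 \<le> unknotting_number (K 3)"
    by (subst (asm) power_increasing_iff) auto
  moreover have "unknotting_number (K 3) \<le> 2"
    using le[of 3] by simp
  moreover have "link_equiv (K 3) knot_9_47"
    using link_equiv_rewrite_steps[OF diagram] closure_9_47 unfolding K_def by blast
  ultimately show ?thesis using le by simp
qed

end
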